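(* Let $N\ge 2$ and let $\rho$ be an absolutely continuous probability measure on $\mathbb{R}^d$. Let $T^1,\dots,T^N$ be the maps of $\mathbb{R}^d$ described in the context, and set $\rho_N=(T^1,T^2,\dots,T^N)_{\#}\rho$. Then $$E_N[\rho]\le C_N(\rho_N)=\int_{\mathbb{R}^{Nd}}\sum_{i\ne j}\frac{1}{|x_i-x_j|}\,d\rho_N(x_1,\dots,x_N)=\int_{\mathbb{R}^d}\sum_{i\neq j}\frac{1}{|T^i(x)-T^j(x)|}\,d\rho(x).$$
   Context: For a probability measure $\rho$ on $\mathbb{R}^d$, $\Pi(\rho)$ is the set of probability measures $\rho_N$ on $(\mathbb{R}^{d})^N$ with $(\pi_i)_{\#}\rho_N=\rho$ for $i=1,\dots,N$, where $\pi_i:(\mathbb{R}^{d})^N\to\mathbb{R}^d$ is the $i$th projection. For $\rho_N\in\Pi(\rho)$, $$C_N(\rho_N)=\int_{\mathbb{R}^{dN}}\sum_{i\ne j}\frac{1}{|x_i-x_j|}\,d\rho_N\in[0,\infty],\qquad E_N[\rho]=\inf_{\rho_N\in\Pi(\rho)}C_N(\rho_N),$$ with $1/0=+\infty$. Polar-like coordinates: neglecting the origin, $\mathbb{R}^d$ is identified with $\mathbb{R}\times\mathbb{P}^{d-1}$ ($\mathbb{P}^{d-1}$ is real projective space, the set of lines through the origin): after (measurably) choosing a unit direction vector on each line $\theta$, $(r,\theta)$ denotes the point at signed distance $r$ from the origin on the line $\theta$. Let $d\theta$ be the uniform measure on $\mathbb{P}^{d-1}$, and write $\rho=\rho(r,\theta)\,dr\,d\theta$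 in these coordinates. One-dimensional construction. Let $\sigma$ be an absolutely continuous finite measure on $\mathbb{R}$ of total mass $M>0$. Set $r^0=-\infty$, $r^i=\inf\{t:\sigma((r^{i-1},t))\ge \frac{M}{N}\}$ for $i=1,\dots,N-1$, $r^N=+\infty$, and $I^i=[r^{i-1},r^i]$ (intersected with $\mathbb{R}$), so $\sigma(I^i)=M/N$. For $m,j\in\{1,\dots,N\}$, let $k\in\{1,\dots,N\}$ with $k\equiv m+j-1\pmod N$; then $F^m$ maps $I^j$ to $I^k$ and is defined ($\sigma$-almost everywhere) for $t\in I^j$ by $\sigma((r^{k-1},F^m(t)))=\sigma((r^{j-1},t))$. For almost every $\theta$ (with $\int_{\mathbb R}\rho(r,\theta)dr>0$), $r\mapsto F^m(r,\theta)$ denotes the map $F^m$ of the one-dimensional construction applied to $\sigma=\rho(r,\theta)\,dr$, and $T^m(r,\theta)=(F^m(r,\theta),\theta)$. *)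

theory Defs
  imports "HOL-Probability.Probability"
begin

definition transport_plans :: "nat \<Rightarrow> 'a::euclidean_space measure \<Rightarrow> (nat \<Rightarrow> 'a) measure set" where
  "transport_plans N \<rho> = {P. prob_space P \<and> sets P = sets (PiM {1..N} (\<lambda>_. borel)) \<and>
     (\<forall>i\<in>{1..N}. distr P borel (\<lambda>x. x i) = \<rho>)}"

text \<open>Values are in \<open>ennreal\<close>, where \<open>1 / 0 = \<infinity>\<close>.\<close>
definition coulomb :: "nat \<Rightarrow> (nat \<Rightarrow> 'a::euclidean_space) \<Rightarrow> ennreal" where
  "coulomb N x = (\<Sum>i\<in>{1..N}. \<Sum>j\<in>{1..N} - {i}. 1 / ennreal (norm (x i - x j)))"

definition plan_cost :: "nat \<Rightarrow> (nat \<Rightarrow> 'a::euclidean_space) measure \<Rightarrow> ennreal" where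
  "plan_cost N P = (\<integral>\<^sup>+x. coulomb N x \<partial>P)"

definition min_cost :: "nat \<Rightarrow> 'a::euclidean_space measure \<Rightarrow> ennreal" where
  "min_cost N \<rho> = (INF P\<in>transport_plans N \<rho>. plan_cost N P)"

text \<open>Completing \<open>\<rho>\<close> lets the push-forward make sense for maps that are only determined
  \<open>\<rho>\<close>-almost everywhere and hence need not be Borel.\<close>
definition joint_push :: "nat \<Rightarrow> (nat \<Rightarrow> 'a \<Rightarrow> 'a) \<Rightarrow> 'a::euclidean_space measure \<Rightarrow> (nat \<Rightarrow> 'a) measure" where
  "joint_push N T \<rho> =
     distr (completion \<rho>) (PiM {1..N} (\<lambda>_. borel)) (\<lambda>x. \<lambda>i\<in>{1..N}. T i x)"

definition lines :: "'a::euclidean_space set set" where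
  "lines = {L. subspace L \<and> dim L = 1}"

text \<open>The Borel sets of the quotient topology induced by \<open>x \<mapsto> span {x}\<close> on the
  complement of the origin.\<close>
definition proj_borel :: "'a::euclidean_space set measure" where
  "proj_borel = sigma lines {U. U \<subseteq> lines \<and> open {x. x \<noteq> 0 \<and> span {x} \<in> U}}"

text \<open>The rotation-invariant probability measure: the law of the line through a uniformly
  distributed point of the unit ball.\<close>
definition proj_uniform :: "'a::euclidean_space set measure" where
  "proj_uniform = distr (restrict_space (uniform_measure lborel (ball 0 1)) (- {0}))
     proj_borel (\<lambda>x. span {x})"

definition unit_direction :: "('a::euclidean_space set \<Rightarrow> 'a) \<Rightarrow> bool" where
  "unit_direction u \<longleftrightarrow> u \<in> measurable proj_borel borel \<and>
     (\<forall>\<theta>\<in>lines. u \<theta> \<in> \<theta> \<and> norm (u \<theta>) = 1)"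

definition polar :: "('a::euclidean_space set \<Rightarrow> 'a) \<Rightarrow> 'a \<Rightarrow> real \<times> 'a set" where
  "polar u x = (x \<bullet> u (span {x}), span {x})"

text \<open>The density of \<open>\<rho>\<close> with respect to \<open>dr d\<theta>\<close>; the Jacobian of the change of variables
  is thus part of it.\<close>
definition polar_density ::
    "('a::euclidean_space set \<Rightarrow> 'a) \<Rightarrow> 'a measure \<Rightarrow> real \<times> 'a set \<Rightarrow> ennreal" where
  "polar_density u \<rho> = RN_deriv (lborel \<Otimes>\<^sub>M proj_uniform)
     (distr (restrict_space \<rho> (- {0})) (lborel \<Otimes>\<^sub>M proj_uniform) (polar u))"

definition line_measure ::
    "('a::euclidean_space set \<Rightarrow> 'a) \<Rightarrow> 'a measure \<Rightarrow> 'a set \<Rightarrow> real measure" where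
  "line_measure u \<rho> \<theta> = density lborel (\<lambda>r. polar_density u \<rho> (r, \<theta>))"

primrec cut :: "real measure \<Rightarrow> nat \<Rightarrow> nat \<Rightarrow> ereal" where
  "cut \<sigma> N 0 = -\<infinity>"
| "cut \<sigma> N (Suc i) =
     (if Suc i < N
      then Inf (ereal ` {t. emeasure \<sigma> {s. cut \<sigma> N i < ereal s \<and> s < t}
                              \<ge> emeasure \<sigma> UNIV / of_nat N})
      else \<infinity>)"

definition piece :: "real measure \<Rightarrow> nat \<Rightarrow> nat \<Rightarrow> real set" where
  "piece \<sigma> N i = {t. cut \<sigma> N (i - 1) \<le> ereal t \<and> ereal t \<le> cut \<sigma> N i}"

text \<open>The index \<open>j\<close> is unambiguous except at the cut points. The number \<open>k\<close> is the element of
  \<open>{1..N}\<close> congruent to \<open>m + j - 1\<close> modulo \<open>N\<close> (for \<open>m, j \<ge> 1\<close>). The description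
  determines the image point for \<open>\<sigma>\<close>-almost every \<open>t\<close>; it can fail to be unique only at levels
  where the distribution function of \<open>\<sigma>\<close> is locally constant, or at end points of the pieces.\<close>
definition cyclic_map :: "real measure \<Rightarrow> nat \<Rightarrow> nat \<Rightarrow> real \<Rightarrow> real" where
  "cyclic_map \<sigma> N m t =
     (let j = (LEAST j. j \<in> {1..N} \<and> t \<in> piece \<sigma> N j);
          k = (m + j - 2) mod N + 1
      in THE s. s \<in> piece \<sigma> N k \<and>
           emeasure \<sigma> {s'. cut \<sigma> N (k - 1) < ereal s' \<and> s' < s} =
           emeasure \<sigma> {t'. cut \<sigma> N (j - 1) < ereal t' \<and> t' < t})"

definition radial_map ::
    "('a::euclidean_space set \<Rightarrow> 'a) \<Rightarrow> 'a measure \<Rightarrow> nat \<Rightarrow> nat \<Rightarrow> 'a \<Rightarrow> 'a" where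
  "radial_map u \<rho> N m x =
     (let (r, \<theta>) = polar u x in cyclic_map (line_measure u \<rho> \<theta>) N m r *\<^sub>R u \<theta>)"

end

(* On a line carrying the finite atomless measure sigma of mass M, with distribution function F,
   the map F^m is, outside a null set, the unique solution s of F s = tau (F t), where tau is the
   rotation by (m - 1) M / N on the circle R / M Z.  Since sigma {F <= p} = p, the rotation
   invariance of Lebesgue measure on the circle shows that F^m preserves sigma.  The equivalence
   F^m t <= s <-> tau (F t) <= F s also gives joint measurability in the radius and the line, so
   integrating over the lines shows that each T^m preserves rho.  Hence rho_N is a transport plan,
   and the cost formula is the change of variables for push-forwards. *)
theory Submission
  imports Defs
begin

section \<open>Cyclic rearrangement on the line\<close>

text \<open>Two obstacles shape the proof. First, F may be constant on intervals, so F^m is not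
  determined pointwise and the \<open>THE\<close> in \<open>cyclic_map\<close> is unspecified at
  some points; moreover, a choice made line by line gives no measurability across lines. Both are
  met by a Borel representative that is set to 0 at irregular points (\<open>radial_part\<close>,
  \<open>transport\<close>). T^m agrees with it almost everywhere, which suffices for the completion
  of rho. Irregular points are negligible because a flat level of F is the level of some rational,
  so countably many levels suffice, and each level set of F is null. Second,
  \<open>polar_density\<close> is a Radon-Nikodym derivative, which carries information only if the
  polar image of rho is absolutely continuous with respect to dr dtheta. This follows from
  \<open>polar_vimage_null\<close> and lets rho be disintegrated along lines into atomless
  measures.\<close>

definition cyclic_shift :: "real \<Rightarrow> nat \<Rightarrow> nat \<Rightarrow> real \<Rightarrow> real" where
  "cyclic_shift A N m p =
     (let q = p + (real m - 1) * A / real N in if q < A then q else q - A)"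

text \<open>At a regular point the level \<open>F t\<close> avoids the multiples of \<open>M / N\<close>, and the shifted level is
  attained by \<open>F\<close> exactly once. Quantifying over rationals keeps the condition jointly measurable
  in \<open>t\<close> and \<open>\<sigma>\<close>; positivity of \<open>measure \<sigma> UNIV\<close> also excludes infinite \<open>\<sigma>\<close>.\<close>
definition regular_point :: "real measure \<Rightarrow> nat \<Rightarrow> nat \<Rightarrow> real \<Rightarrow> bool" where
  "regular_point \<sigma> N m t \<longleftrightarrow> 0 < measure \<sigma> UNIV \<and>
     (\<forall>j\<in>{..N}. real N * cdf \<sigma> t \<noteq> real j * measure \<sigma> UNIV) \<and>
     (\<forall>a b :: rat. a < b \<longrightarrow>
        \<not> (cdf \<sigma> (of_rat a) = cyclic_shift (measure \<sigma> UNIV) N m (cdf \<sigma> t) \<and>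
           cdf \<sigma> (of_rat b) = cyclic_shift (measure \<sigma> UNIV) N m (cdf \<sigma> t)))"

locale atomless_measure = finite_borel_measure +
  assumes no_atoms: "measure M {x} = 0"
begin

abbreviation "mass \<equiv> measure M UNIV"

section \<open>Levels of a continuous distribution function\<close>

lemma continuous_cdf: "continuous_on UNIV (cdf M)"
  using isCont_cdf no_atoms by (simp add: continuous_at_imp_continuous_on)

lemma measure_lessThan: "measure M {..<t} = cdf M t"
proof -
  have "isCont (cdf M) t" using isCont_cdf no_atoms by simp
  then have "(cdf M \<longlongrightarrow> cdf M t) (at_left t)"
    by (simp add: isCont_def filterlim_at_split)
  from tendsto_unique[OF _ cdf_at_left this] show ?thesis by simp
qed

lemma cdf_le_mass: "cdf M t \<le> mass"
  using cdf_bounded[of t] by (simp add: borel_UNIV)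

lemma ex_cdf_less:
  assumes "0 < p" shows "\<exists>a. cdf M a < p"
proof -
  have "\<forall>\<^sub>F a in at_bot. cdf M a < p"
    using cdf_lim_at_bot assms by (rule order_tendstoD)
  then show ?thesis by (rule eventually_happens'[OF trivial_limit_at_bot_linorder])
qed

lemma ex_cdf_greater:
  assumes "p < mass" shows "\<exists>b. p < cdf M b"
proof -
  have "\<forall>\<^sub>F b in at_top. p < cdf M b"
    using cdf_lim_at_top assms by (intro order_tendstoD(1)) (auto simp: borel_UNIV)
  then show ?thesis by (rule eventually_happens'[OF trivial_limit_at_top_linorder])
qed

lemma cdf_less_imp_less: "cdf M a < cdf M b \<Longrightarrow> a < b"
  using cdf_nondecreasing[of b a] by linarith

lemma ex_cdf_eq:
  assumes "0 < p" "p < mass" shows "\<exists>s. cdf M s = p"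
proof -
  obtain a b where ab: "cdf M a < p" "p < cdf M b"
    using ex_cdf_less ex_cdf_greater assms by blast
  then have "a < b" using cdf_less_imp_less[of a b] by linarith
  have "\<exists>s\<ge>a. s \<le> b \<and> cdf M s = p"
  proof (rule IVT')
    show "continuous_on {a..b} (cdf M)"
      by (rule continuous_on_subset[OF continuous_cdf]) simp
  qed (use ab \<open>a < b\<close> in auto)
  then show ?thesis by blast
qed

text \<open>The witness is the least point of the closed superlevel set of \<open>p\<close>. The
  equivalence lets \<open>at_level_cut\<close> recognise the set in the definition of
  \<open>cut\<close> as a closed half-line.\<close>

lemma ex_quantile:
  assumes "0 < p" "p < mass"
  obtains c where "cdf M c = p" "\<And>t. p \<le> cdf M t \<longleftrightarrow> c \<le> t"
proof -
  define S where "S = {t. p \<le> cdf M t}"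
  obtain s where s: "cdf M s = p" using ex_cdf_eq assms by blast
  obtain a where a: "cdf M a < p" using ex_cdf_less assms by blast
  have "closed S" unfolding S_def
    by (intro closed_Collect_le continuous_on_const continuous_cdf)
  moreover have "s \<in> S" by (simp add: S_def s)
  moreover have bdd: "bdd_below S"
  proof (rule bdd_belowI)
    fix t assume "t \<in> S"
    then have "cdf M a < cdf M t" using a by (simp add: S_def)
    then show "a \<le> t" by (rule less_imp_le[OF cdf_less_imp_less])
  qed
  ultimately have "Inf S \<in> S" "Inf S \<le> s"
    using closed_contains_Inf[of S] cInf_lower[of s S] by blast+
  then have "p \<le> cdf M (Inf S)" "cdf M (Inf S) \<le> p"
    using cdf_nondecreasing[of "Inf S" s] s by (simp_all add: S_def)
  then have eq: "cdf M (Inf S) = p" by simp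
  show ?thesis
  proof (rule that[OF eq])
    fix t
    show "p \<le> cdf M t \<longleftrightarrow> Inf S \<le> t"
    proof
      assume "p \<le> cdf M t"
      then have "t \<in> S" by (simp add: S_def)
      then show "Inf S \<le> t" by (rule cInf_lower[OF _ bdd])
    next
      assume "Inf S \<le> t"
      from cdf_nondecreasing[OF this] show "p \<le> cdf M t" by (simp add: eq)
    qed
  qed
qed

text \<open>This says that F pushes \<open>M\<close> forward to Lebesgue measure on the interval
  from 0 to \<open>mass\<close>. The sublevel set lies inside \<open>{..s}\<close> if F s is
  slightly above \<open>p\<close> and contains \<open>{..s}\<close> if F s is slightly below. Only
  levels strictly between 0 and \<open>mass\<close> need be attained, so the two extreme values of
  \<open>p\<close> are treated apart.\<close>

lemma measure_cdf_le:
  assumes "0 \<le> p" "p \<le> mass"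
  shows "measure M {t. cdf M t \<le> p} = p" "{t. cdf M t \<le> p} \<in> sets M"
proof -
  have "closed {t. cdf M t \<le> p}"
    by (intro closed_Collect_le continuous_on_const continuous_cdf)
  then show m: "{t. cdf M t \<le> p} \<in> sets M" by (intro sets_M borel_closed)
  have up: "measure M {t. cdf M t \<le> p} \<le> q" if q: "p < q" "q < mass" for q
  proof -
    obtain s where s: "cdf M s = q" using ex_cdf_eq[of q] q assms by auto
    have "{t. cdf M t \<le> p} \<subseteq> {..s}"
    proof
      fix t assume "t \<in> {t. cdf M t \<le> p}"
      then have "cdf M t < cdf M s" using q s by simp
      then show "t \<in> {..s}" using cdf_less_imp_less[of t s] by simp
    qed
    then show ?thesis using s by (auto simp: cdf_def intro!: finite_measure_mono)
  qed
  have le: "measure M {t. cdf M t \<le> p} \<le> p"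
  proof (cases "p = mass")
    case True
    then show ?thesis using bounded_measure[of "{t. cdf M t \<le> p}"] by (simp add: borel_UNIV)
  next
    case False
    with assms have "p < mass" by simp
    then show ?thesis by (rule dense_ge_bounded) (rule up)
  qed
  have ge: "q \<le> measure M {t. cdf M t \<le> p}" if q: "0 < q" "q < p" for q
  proof -
    obtain s where s: "cdf M s = q" using ex_cdf_eq[of q] q assms by auto
    have "{..s} \<subseteq> {t. cdf M t \<le> p}"
      using q s by (auto dest: cdf_nondecreasing)
    then show ?thesis using s m by (auto simp: cdf_def intro!: finite_measure_mono)
  qed
  have "p \<le> measure M {t. cdf M t \<le> p}"
  proof (cases "p = 0")
    case False
    with assms have "0 < p" by simp
    then show ?thesis by (rule dense_le_bounded) (rule ge)
  qed auto
  with le show "measure M {t. cdf M t \<le> p} = p" by simp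
qed

text \<open>Absence of atoms alone is not enough, since a level set may be a whole interval. It lies
  in the difference of the sublevel sets of \<open>p\<close> and any smaller \<open>q\<close>, whose
  measure is \<open>p - q\<close>; then \<open>q\<close> tends to \<open>p\<close>. For
  \<open>p = 0\<close> the level set is itself a sublevel set.\<close>

lemma AE_cdf_neq: "AE t in M. cdf M t \<noteq> p"
proof (cases "0 \<le> p \<and> p \<le> mass")
  case False
  then have "cdf M t \<noteq> p" for t using cdf_nonneg cdf_le_mass by blast
  then show ?thesis by simp
next
  case True
  have null: "measure M {t. cdf M t = p} = 0"
  proof (rule antisym)
    have up: "measure M {t. cdf M t = p} \<le> p - q" if q: "0 \<le> q" "q < p" for q
    proof -
      have "measure M {t. cdf M t = p} \<le> measure M ({t. cdf M t \<le> p} - {t. cdf M t \<le> q})"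
        using measure_cdf_le(2)[of p] measure_cdf_le(2)[of q] q True
        by (intro finite_measure_mono) auto
      also have "\<dots> = p - q"
        using q True by (subst finite_measure_Diff) (auto simp: measure_cdf_le)
      finally show ?thesis .
    qed
    have bd: "q \<le> p - measure M {t. cdf M t = p}" if "0 < q" "q < p" for q
      using that up[of q] by linarith
    have "p \<le> p - measure M {t. cdf M t = p}" if "0 < p"
      by (rule dense_le_bounded[OF that]) (rule bd)
    moreover have "measure M {t. cdf M t = p} \<le> 0" if "p = 0"
    proof -
      have "{t. cdf M t = 0} = {t. cdf M t \<le> 0}" by (auto intro: antisym cdf_nonneg)
      then show ?thesis using measure_cdf_le(1)[of 0] that True by simp
    qed
    ultimately show "measure M {t. cdf M t = p} \<le> 0" using True by linarith
  qed simp
  have "closed {t. cdf M t = p}"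
    by (intro closed_Collect_eq continuous_on_const continuous_cdf)
  then have "{t. cdf M t = p} \<in> sets M" by (intro sets_M borel_closed)
  then have "{t. cdf M t = p} \<in> null_sets M"
    using null by (simp add: null_sets_def emeasure_eq_measure)
  from AE_not_in[OF this] show ?thesis by simp
qed

section \<open>Cut points, pieces and the cyclic map in terms of levels\<close>

text \<open>The level \<open>v\<close> of an extended cut point \<open>e\<close>, where \<open>F (-\<infinity>) = 0\<close>.\<close>
definition at_level :: "ereal \<Rightarrow> real \<Rightarrow> bool" where
  "at_level e v \<longleftrightarrow> e = -\<infinity> \<and> v = 0 \<or> (\<exists>c. e = ereal c \<and> cdf M c = v)"

lemma at_level_le:
  assumes "at_level e v" "e \<le> ereal s" shows "v \<le> cdf M s"
  using assms by (auto simp: at_level_def cdf_nonneg intro: cdf_nondecreasing)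

lemma at_level_ge:
  assumes "at_level e v" "ereal s \<le> e" shows "cdf M s \<le> v"
  using assms by (auto simp: at_level_def intro: cdf_nondecreasing)

text \<open>No assumption that \<open>s\<close> lies beyond \<open>e\<close> is needed: if it does
  not, the set is empty, the difference of levels is at most 0, and \<open>ennreal\<close> truncates
  it to 0.\<close>

lemma emeasure_above_level:
  assumes "at_level e v"
  shows "emeasure M {s'. e < ereal s' \<and> s' < s} = ennreal (cdf M s - v)"
proof -
  consider "e = -\<infinity>" "v = 0" | c where "e = ereal c" "cdf M c = v"
    using assms by (auto simp: at_level_def)
  then show ?thesis
  proof cases
    case 1
    then have "{s'. e < ereal s' \<and> s' < s} = {..<s}" by auto
    then show ?thesis using 1 by (simp add: emeasure_eq_measure measure_lessThan)
  next
    case 2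
    have set: "{s'. e < ereal s' \<and> s' < s} = {..<s} - {..c}" using 2 by auto
    show ?thesis
    proof (cases "c < s")
      case True
      then have "measure M ({..<s} - {..c}) = cdf M s - v"
        using 2 by (subst finite_measure_Diff) (auto simp: measure_lessThan, simp add: cdf_def)
      then show ?thesis by (simp add: set emeasure_eq_measure)
    next
      case False
      then have empty: "{..<s} - {..c} = {}" by auto
      have "cdf M s \<le> v" using False 2 cdf_nondecreasing[of s c] by simp
      then show ?thesis unfolding set empty by (simp add: ennreal_neg)
    qed
  qed
qed

text \<open>By induction, the mass beyond cut \<open>i\<close> reaches one N-th of the total exactly
  when F reaches the next multiple, so the next cut is the quantile of that multiple. The last cut
  is infinite and has no level, hence \<open>i < N\<close>.\<close>

lemma at_level_cut:
  assumes "0 < mass" "i < N"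
  shows "at_level (cut M N i) (real i * mass / real N)"
  using assms(2)
proof (induction i)
  case 0
  then show ?case by (simp add: at_level_def)
next
  case (Suc i)
  then have N: "0 < real N" and IH: "at_level (cut M N i) (real i * mass / real N)" by simp_all
  define p where "p = real (Suc i) * mass / real N"
  have "real (Suc i) * mass < real N * mass"
    by (rule mult_strict_right_mono) (use Suc.prems assms(1) in simp_all)
  then have "0 < p" "p < mass"
    using N assms(1) by (simp_all add: p_def pos_divide_less_eq mult.commute add_pos_nonneg)
  then obtain c where c: "cdf M c = p" "\<And>t. p \<le> cdf M t \<longleftrightarrow> c \<le> t"
    using ex_quantile by blast
  have "emeasure M UNIV / of_nat N = ennreal (mass / real N)"
    using N by (simp add: emeasure_eq_measure ennreal_of_nat_eq_real_of_nat divide_ennreal)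
  moreover have p: "p = real i * mass / real N + mass / real N"
    by (simp add: p_def add_divide_distrib distrib_right add.commute)
  then have "mass / real N \<le> cdf M t - real i * mass / real N \<longleftrightarrow> p \<le> cdf M t" for t
    by auto
  \<comment> \<open>Since the threshold is positive, truncating negative differences to 0 in
    \<open>ennreal\<close> cannot create a false inequality.\<close>
  moreover have h: "0 < mass / real N" using N assms(1) by simp
  moreover have "p \<le> cdf M t \<Longrightarrow> real i * mass / real N \<le> cdf M t" for t
    using p h by linarith
  ultimately have "emeasure M UNIV / of_nat N
      \<le> emeasure M {s. cut M N i < ereal s \<and> s < t} \<longleftrightarrow> c \<le> t" for t
    by (auto simp: emeasure_above_level[OF IH] ennreal_le_iff2 c(2)[symmetric])
  then have "cut M N (Suc i) = Inf (ereal ` {c..})"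
    using Suc.prems by (simp add: atLeast_def)
  also have "\<dots> = ereal c"
    by (rule Inf_eqI) auto
  finally show ?case using c(1) by (auto simp: at_level_def p_def)
qed

text \<open>The necessary bounds are weak and the sufficient ones strict because a level that is a
  multiple of \<open>mass / N\<close> does not decide membership: F can stay flat beyond a cut
  point, and neighbouring pieces share that point.\<close>

lemma cdf_piece_bounds:
  assumes "0 < mass" "k \<in> {1..N}"
  shows "s \<in> piece M N k \<Longrightarrow> (real k - 1) * mass / real N \<le> cdf M s"
    and "s \<in> piece M N k \<Longrightarrow> cdf M s \<le> real k * mass / real N"
    and "(real k - 1) * mass / real N < cdf M s \<Longrightarrow> cdf M s < real k * mass / real N \<Longrightarrow>
      s \<in> piece M N k"
proof -
  have lower: "at_level (cut M N (k - 1)) ((real k - 1) * mass / real N)"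
    using at_level_cut[OF assms(1), of "k - 1" N] assms(2) by (auto simp: of_nat_diff)
  have upper: "cut M N k = \<infinity> \<and> k = N \<or> at_level (cut M N k) (real k * mass / real N)"
  proof (cases "k < N")
    case True
    then show ?thesis using at_level_cut[OF assms(1)] by blast
  next
    case False
    then have "k = N" "Suc (N - 1) = N" using assms(2) by auto
    then show ?thesis using cut.simps(2)[of M N "N - 1"] by simp
  qed
  show "s \<in> piece M N k \<Longrightarrow> (real k - 1) * mass / real N \<le> cdf M s"
    using at_level_le[OF lower] by (simp add: piece_def)
  show "s \<in> piece M N k \<Longrightarrow> cdf M s \<le> real k * mass / real N"
    using upper at_level_ge[of "cut M N k"] cdf_le_mass[of s] assms(2) by (auto simp: piece_def)
  assume "(real k - 1) * mass / real N < cdf M s" "cdf M s < real k * mass / real N"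
  then have "\<not> ereal s \<le> cut M N (k - 1)" "\<not> cut M N k \<le> ereal s"
    using at_level_ge[OF lower] upper at_level_le[of "cut M N k" _ s] by force+
  then show "s \<in> piece M N k" by (simp add: piece_def not_le less_imp_le)
qed

text \<open>At a regular point the rotated level lies strictly inside the level range of piece
  \<open>k\<close>. Membership in that piece is then automatic, and the condition under
  \<open>THE\<close> collapses to one equation for F, solvable by continuity and uniquely by
  regularity.\<close>

lemma cyclic_map_regular:
  assumes m: "m \<in> {1..N}" and reg: "regular_point M N m t"
  shows "cdf M (cyclic_map M N m t) = cyclic_shift mass N m (cdf M t)"
    and "cdf M s = cyclic_shift mass N m (cdf M t) \<Longrightarrow> s = cyclic_map M N m t"
proof -
  have mass: "0 < mass" and N: "0 < real N"
    using reg m by (auto simp: regular_point_def)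
  \<comment> \<open>Levels are counted in units of the mass of one piece. Regularity makes
    \<open>x\<close> differ from 0, ..., N, so rounding down gives the index of the only piece that
    contains \<open>t\<close>.\<close>
  define h where "h = mass / real N"
  have h: "0 < h" "mass = real N * h" using mass N by (simp_all add: h_def)
  define x where "x = cdf M t / h"
  have x: "cdf M t = x * h" using h(1) by (simp add: x_def)
  have xneq: "x \<noteq> real i" if "i \<le> N" for i
  proof
    assume "x = real i"
    then have "real N * cdf M t = real i * mass" unfolding x h(2) by simp
    then show False using reg that unfolding regular_point_def by (meson atMost_iff)
  qed
  have x0: "0 < x" using xneq[of 0] cdf_nonneg[of t] h(1) by (simp add: x_def)
  have "x \<le> real N" using cdf_le_mass[of t] h unfolding x by simp
  then have xN: "x < real N" using xneq[of N] by simp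
  define j where "j = nat \<lfloor>x\<rfloor> + 1"
  have j: "real j - 1 < x" "x < real j"
  proof -
    have jx: "real j - 1 = of_int \<lfloor>x\<rfloor>" using x0 by (simp add: j_def)
    show "x < real j" using jx by linarith
    have r: "real (j - 1) = real j - 1" by (simp add: j_def)
    have le: "real j - 1 \<le> x" using jx by linarith
    then have "real (j - 1) \<le> real N" using r xN by linarith
    then have "x \<noteq> real (j - 1)" by (intro xneq) simp
    then show "real j - 1 < x" using le r by linarith
  qed
  then have jN: "j \<in> {1..N}" using x0 xN by (auto simp: j_def)
  have least: "(LEAST j. j \<in> {1..N} \<and> t \<in> piece M N j) = j"
  proof (rule Least_equality)
    show "j \<in> {1..N} \<and> t \<in> piece M N j"
      using j h jN cdf_piece_bounds(3)[OF mass jN] by (simp add: x mult.assoc[symmetric] N)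
  next
    fix i assume i: "i \<in> {1..N} \<and> t \<in> piece M N i"
    then have "cdf M t \<le> real i * h"
      using cdf_piece_bounds(2)[OF mass, of i N t] by (simp add: h_def)
    then have "x \<le> real i" using h(1) by (simp add: x)
    then show "j \<le> i" using j(1) by linarith
  qed
  define k where "k = (m + j - 2) mod N + 1"
  define \<tau> where "\<tau> = cyclic_shift mass N m (cdf M t)"
  have k: "k \<in> {1..N}" using m by (auto simp: k_def Suc_le_eq)
  have "(real m - 1) * mass / real N = (real m - 1) * h" by (simp add: h_def)
  then have shift: "\<tau> = (if (x + real m - 1) * h < real N * h then (x + real m - 1) * h
      else (x + real m - 1 - real N) * h)"
    by (simp add: \<tau>_def cyclic_shift_def Let_def h(2) x algebra_simps)
  \<comment> \<open>The level wraps past \<open>mass\<close> exactly when the index wraps past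
    \<open>N\<close>: as \<open>x\<close> lies strictly between \<open>j - 1\<close> and
    \<open>j\<close>, both are decided by \<open>m + j - 2 < N\<close>. The offset within the piece
    is kept.\<close>
  have tau: "\<tau> = (x - (real j - 1) + (real k - 1)) * h"
  proof (cases "m + j - 2 < N")
    case True
    then have "real k = real m + real j - 1"
      using m jN by (simp add: k_def of_nat_diff)
    moreover have "m + j \<le> N + 1" using True m jN by auto
    then have "real (m + j) \<le> real (N + 1)" by (rule of_nat_mono)
    then have "x + real m - 1 < real N" using j(2) by linarith
    ultimately show ?thesis using h(1) by (simp add: shift)
  next
    case False
    \<comment> \<open>Since \<open>m\<close> and \<open>j\<close> are at most \<open>N\<close>, a
      single subtraction of \<open>N\<close> computes the remainder.\<close>
    define d where "d = m + j - 2 - N"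
    have "(m + j - 2) mod N = d"
      using False m jN by (subst le_mod_geq) (auto simp: d_def)
    moreover have "m + j = d + N + 2"
      using False m jN by (auto simp: d_def)
    then have "real (m + j) = real (d + N + 2)" by (rule arg_cong)
    then have "real m + real j = real d + real N + 2" by simp
    ultimately have "real k = real m + real j - 1 - real N" "real N \<le> real m + real j - 2"
      by (simp_all add: k_def)
    moreover from this(2) have "\<not> x + real m - 1 < real N" using j(1) by linarith
    ultimately show ?thesis using h(1) by (simp add: shift)
  qed
  have tau_bounds: "(real k - 1) * h < \<tau>" "\<tau> < real k * h"
    using j h(1) unfolding tau by simp_all
  have "s \<in> piece M N k \<and>
           emeasure M {s'. cut M N (k - 1) < ereal s' \<and> s' < s} =
           emeasure M {t'. cut M N (j - 1) < ereal t' \<and> t' < t} \<longleftrightarrow> cdf M s = \<tau>" for s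
  proof -
    have lev: "at_level (cut M N (i - 1)) ((real i - 1) * h)" if "i \<in> {1..N}" for i
      using at_level_cut[OF mass, of "i - 1" N] that by (auto simp: of_nat_diff h_def)
    have eq: "emeasure M {s'. cut M N (k - 1) < ereal s' \<and> s' < s} =
           emeasure M {t'. cut M N (j - 1) < ereal t' \<and> t' < t} \<longleftrightarrow>
        ennreal (cdf M s - (real k - 1) * h) = ennreal (\<tau> - (real k - 1) * h)"
      unfolding emeasure_above_level[OF lev[OF k]] emeasure_above_level[OF lev[OF jN]] tau x
      by (simp add: algebra_simps)
    show ?thesis
    proof
      assume *: "s \<in> piece M N k \<and>
           emeasure M {s'. cut M N (k - 1) < ereal s' \<and> s' < s} =
           emeasure M {t'. cut M N (j - 1) < ereal t' \<and> t' < t}"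
      then have "(real k - 1) * h \<le> cdf M s"
        using cdf_piece_bounds(1)[OF mass k] by (simp add: h_def)
      then show "cdf M s = \<tau>" using * eq tau_bounds by simp
    next
      assume "cdf M s = \<tau>"
      then show "s \<in> piece M N k \<and>
           emeasure M {s'. cut M N (k - 1) < ereal s' \<and> s' < s} =
           emeasure M {t'. cut M N (j - 1) < ereal t' \<and> t' < t}"
        using eq tau_bounds cdf_piece_bounds(3)[OF mass k, of s] by (simp add: h_def)
    qed
  qed
  then have map: "cyclic_map M N m t = (THE s. cdf M s = \<tau>)"
    unfolding cyclic_map_def least Let_def k_def[symmetric] by simp
  have "\<exists>s. cdf M s = \<tau>"
  proof (rule ex_cdf_eq)
    have "0 \<le> (real k - 1) * h" using k h(1) by simp
    then show "0 < \<tau>" using tau_bounds by linarith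
    have "real k * h \<le> real N * h" using k h(1) by simp
    then show "\<tau> < mass" using tau_bounds h(2) by linarith
  qed
  moreover have unique: "s = s'" if "cdf M s = \<tau>" "cdf M s' = \<tau>" for s s'
  proof -
    \<comment> \<open>Two solutions would force F to be constant between them, in particular at two
      rationals, which regularity forbids.\<close>
    have False if less: "a < b" and ab: "cdf M a = \<tau>" "cdf M b = \<tau>" for a b
    proof -
      obtain c where c: "a < of_rat c" "of_rat c < b" using of_rat_dense[OF less] by blast
      obtain d where d: "of_rat c < (of_rat d :: real)" "of_rat d < b"
        using of_rat_dense[OF c(2)] by blast
      have "cdf M r = \<tau>" if "a < r" "r < b" for r
        using cdf_nondecreasing[of a r] cdf_nondecreasing[of r b] that ab by simp
      then have "cdf M (of_rat c) = \<tau>" "cdf M (of_rat d) = \<tau>" using c d by simp_all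
      moreover have "c < d" using d(1) by (simp only: of_rat_less)
      ultimately show False using reg unfolding regular_point_def \<tau>_def by blast
    qed
    from this[of s s'] this[of s' s] show ?thesis
      using that by (cases s s' rule: linorder_cases) auto
  qed
  ultimately have ex1: "\<exists>!s. cdf M s = \<tau>" by blast
  from theI'[OF ex1] have *: "cdf M (cyclic_map M N m t) = \<tau>" by (simp add: map)
  then show "cdf M (cyclic_map M N m t) = cyclic_shift mass N m (cdf M t)" by (simp add: \<tau>_def)
  show "s = cyclic_map M N m t" if "cdf M s = cyclic_shift mass N m (cdf M t)"
    using unique[OF _ *] that by (simp add: \<tau>_def)
qed

text \<open>One direction is monotonicity of F. For the other, a point \<open>s\<close> to the left
  of the image whose level is not below the rotated one would be a second solution of the defining
  equation.\<close>

lemma cyclic_map_le_iff: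
  assumes "m \<in> {1..N}" "regular_point M N m t"
  shows "cyclic_map M N m t \<le> s \<longleftrightarrow> cyclic_shift mass N m (cdf M t) \<le> cdf M s"
proof
  assume "cyclic_map M N m t \<le> s"
  from cdf_nondecreasing[OF this]
  show "cyclic_shift mass N m (cdf M t) \<le> cdf M s" by (simp add: cyclic_map_regular(1)[OF assms])
next
  assume le: "cyclic_shift mass N m (cdf M t) \<le> cdf M s"
  show "cyclic_map M N m t \<le> s"
  proof (rule ccontr)
    assume "\<not> cyclic_map M N m t \<le> s"
    then have "cdf M s \<le> cyclic_shift mass N m (cdf M t)"
      using cdf_nondecreasing[of s "cyclic_map M N m t"] by (simp add: cyclic_map_regular(1)[OF assms])
    then have "s = cyclic_map M N m t"
      using le by (intro cyclic_map_regular(2)[OF assms]) simp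
    with \<open>\<not> cyclic_map M N m t \<le> s\<close> show False by simp
  qed
qed

text \<open>For a fixed rational, each of the two branches of the shift allows only one value of F t
  at which the rotated level is the level of that rational. Excluding these countably many null
  level sets gives even more than regularity asks.\<close>

lemma AE_regular_point:
  assumes "0 < mass" "0 < N" shows "AE t in M. regular_point M N m t"
proof -
  have 1: "AE t in M. \<forall>j\<in>{..N}. real N * cdf M t \<noteq> real j * mass"
  proof (rule AE_finite_allI)
    fix j assume "j \<in> {..N}"
    show "AE t in M. real N * cdf M t \<noteq> real j * mass"
      using AE_cdf_neq[of "real j * mass / real N"] by eventually_elim (use assms in \<open>auto simp: field_simps\<close>)
  qed simp
  have 2: "AE t in M. \<forall>a :: rat. cdf M (of_rat a) \<noteq> cyclic_shift mass N m (cdf M t)"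
  proof (subst AE_all_countable, rule allI)
    fix a :: rat
    define c where "c = (real m - 1) * mass / real N"
    show "AE t in M. cdf M (of_rat a) \<noteq> cyclic_shift mass N m (cdf M t)"
      using AE_cdf_neq[of "cdf M (of_rat a) - c"] AE_cdf_neq[of "cdf M (of_rat a) + mass - c"]
      by eventually_elim (auto simp: cyclic_shift_def Let_def c_def[symmetric])
  qed
  from 1 2 show ?thesis
    by eventually_elim (use assms in \<open>auto simp: regular_point_def\<close>)
qed

text \<open>The preimage of the interval from 0 to \<open>q\<close> under the rotation by
  \<open>c\<close> is an initial and a final arc if \<open>c\<close> is at most \<open>q\<close>,
  and a single arc otherwise; its length is \<open>q\<close> in both cases. The level
  \<open>mass - c\<close>, where the branches meet, is null and is ignored.\<close>

lemma measure_cyclic_shift_le: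
  assumes "m \<in> {1..N}" "0 \<le> q" "q \<le> mass"
  shows "measure M {t. cyclic_shift mass N m (cdf M t) \<le> q} = q"
    and "{t. cyclic_shift mass N m (cdf M t) \<le> q} \<in> sets M"
proof -
  define c where "c = (real m - 1) * mass / real N"
  have N: "0 < real N" using assms(1) by auto
  have "(real m - 1) * mass \<le> real N * mass"
    by (rule mult_right_mono) (use assms(1) in auto)
  then have c: "0 \<le> c" "c \<le> mass"
    using assms(1) N by (auto simp: c_def pos_divide_le_eq mult.commute)
  have [measurable_cong]: "sets M = sets borel" by (rule M_is_borel)
  have [measurable]: "cdf M \<in> borel_measurable borel"
    by (rule borel_measurable_continuous_onI[OF continuous_cdf])
  have "(\<lambda>t. cyclic_shift mass N m (cdf M t)) \<in> borel_measurable M"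
    unfolding cyclic_shift_def Let_def by measurable
  then have "{t \<in> space M. cyclic_shift mass N m (cdf M t) \<le> q} \<in> sets M" by measurable
  then show sets: "{t. cyclic_shift mass N m (cdf M t) \<le> q} \<in> sets M" by (simp add: borel_UNIV)
  let ?L = "\<lambda>p. {t. cdf M t \<le> p}"
  have iff: "cyclic_shift mass N m p \<le> q \<longleftrightarrow>
      p < mass - c \<and> p \<le> q - c \<or> mass - c \<le> p \<and> p \<le> q + mass - c" for p
    by (auto simp: cyclic_shift_def Let_def c_def[symmetric])
  have L: "measure M (?L p) = p" "?L p \<in> sets M" if "0 \<le> p" "p \<le> mass" for p
    using measure_cdf_le that by blast+
  show "measure M {t. cyclic_shift mass N m (cdf M t) \<le> q} = q"
  proof (cases "c \<le> q")
    case True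
    have "measure M {t. cyclic_shift mass N m (cdf M t) \<le> q} = measure M (?L (q - c) \<union> (UNIV - ?L (mass - c)))"
    proof (rule finite_measure_eq_AE)
      show "AE t in M. t \<in> {t. cyclic_shift mass N m (cdf M t) \<le> q} \<longleftrightarrow>
          t \<in> ?L (q - c) \<union> (UNIV - ?L (mass - c))"
        using AE_cdf_neq[of "mass - c"]
      proof eventually_elim
        case (elim t)
        then show ?case using True assms(3) cdf_le_mass[of t] by (auto simp: iff)
      qed
    qed (use sets L assms c True in auto)
    also have "\<dots> = measure M (?L (q - c)) + measure M (UNIV - ?L (mass - c))"
      using L assms c True by (intro finite_measure_Union) auto
    also have "measure M (UNIV - ?L (mass - c)) = mass - (mass - c)"
      using L[of "mass - c"] c by (subst finite_measure_Diff) auto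
    finally show ?thesis using L[of "q - c"] True assms c by simp
  next
    case False
    have "measure M {t. cyclic_shift mass N m (cdf M t) \<le> q} = measure M (?L (q + mass - c) - ?L (mass - c))"
    proof (rule finite_measure_eq_AE)
      show "AE t in M. t \<in> {t. cyclic_shift mass N m (cdf M t) \<le> q} \<longleftrightarrow>
          t \<in> ?L (q + mass - c) - ?L (mass - c)"
        using AE_cdf_neq[of "mass - c"]
      proof eventually_elim
        case (elim t)
        then show ?case using False assms(2) cdf_nonneg[of t] by (auto simp: iff)
      qed
    qed (use sets L assms c False in auto)
    also have "\<dots> = q"
      using L[of "q + mass - c"] L[of "mass - c"] False assms c by (subst finite_measure_Diff) auto
    finally show ?thesis .
  qed
qed

lemma distr_cyclic_map:
  assumes mass: "0 < mass" and m: "m \<in> {1..N}"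
    and g [measurable]: "g \<in> borel_measurable borel"
    and eq: "\<And>t. regular_point M N m t \<Longrightarrow> g t = cyclic_map M N m t"
  shows "distr M borel g = M"
proof -
  have [measurable_cong]: "sets M = sets borel" by (rule M_is_borel)
  interpret D: finite_borel_measure "distr M borel g"
    by (intro finite_borel_measure.intro finite_measure_distr finite_borel_measure_axioms.intro) simp_all
  have "cdf (distr M borel g) s = cdf M s" for s
  proof -
    have "cdf (distr M borel g) s = measure M {t. g t \<le> s}"
      by (simp add: cdf_def measure_distr borel_UNIV vimage_def)
    also have "\<dots> = measure M {t. cyclic_shift mass N m (cdf M t) \<le> cdf M s}"
    proof (rule finite_measure_eq_AE)
      show "AE t in M. t \<in> {t. g t \<le> s} \<longleftrightarrow> t \<in> {t. cyclic_shift mass N m (cdf M t) \<le> cdf M s}"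
        using AE_regular_point[OF mass, of N m] m
        by (auto elim!: eventually_mono simp: eq cyclic_map_le_iff[OF m])
      show "{t. g t \<le> s} \<in> sets M" by simp
      show "{t. cyclic_shift mass N m (cdf M t) \<le> cdf M s} \<in> sets M"
        by (rule measure_cyclic_shift_le(2)[OF m cdf_nonneg cdf_le_mass])
    qed
    also have "\<dots> = cdf M s" by (rule measure_cyclic_shift_le(1)[OF m cdf_nonneg cdf_le_mass])
    finally show ?thesis .
  qed
  then show ?thesis
    by (intro cdf_unique' D.finite_borel_measure_axioms finite_borel_measure_axioms ext)
qed

end

section \<open>Polar coordinates\<close>

lemma space_proj_borel [simp]: "space proj_borel = lines"
  unfolding proj_borel_def by (rule space_measure_of) auto

lemma span_in_lines: "x \<noteq> 0 \<Longrightarrow> span {x} \<in> lines"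
  by (simp add: lines_def)

lemma measurable_span_singleton:
  "(\<lambda>x. span {x}) \<in> measurable (restrict_space borel (- {0})) proj_borel"
  unfolding proj_borel_def
proof (rule measurable_measure_of)
  show "{U. U \<subseteq> lines \<and> open {x::'a. x \<noteq> 0 \<and> span {x} \<in> U}} \<subseteq> Pow lines" by auto
  show "(\<lambda>x::'a. span {x}) \<in> space (restrict_space borel (- {0})) \<rightarrow> lines"
    by (auto simp: space_restrict_space span_in_lines)
  fix U :: "'a set set" assume "U \<in> {U. U \<subseteq> lines \<and> open {x::'a. x \<noteq> 0 \<and> span {x} \<in> U}}"
  then have "{x. x \<noteq> 0 \<and> span {x} \<in> U} \<in> sets borel" by auto
  moreover have "(\<lambda>x. span {x}) -` U \<inter> space (restrict_space borel (- {0})) = {x. x \<noteq> 0 \<and> span {x} \<in> U}"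
    by (auto simp: space_restrict_space)
  ultimately show "(\<lambda>x. span {x}) -` U \<inter> space (restrict_space borel (- {0}))
      \<in> sets (restrict_space borel (- {0}))"
    by (auto simp: sets_restrict_space_iff)
qed

lemma sets_proj_uniform [measurable_cong]: "sets proj_uniform = sets proj_borel"
  by (simp add: proj_uniform_def)

lemma space_proj_uniform [simp]: "space proj_uniform = lines"
  by (simp add: proj_uniform_def)

lemma emeasure_unit_ball: "emeasure lborel (ball (0::'a::euclidean_space) 1) \<noteq> 0"
  "emeasure lborel (ball (0::'a) 1) < \<infinity>"
  using content_ball_pos[of 1 "0::'a"] emeasure_lborel_ball_finite[of "0::'a" 1]
  by (auto simp: measure_def)

lemma measurable_span_unit_ball:
  "(\<lambda>x. span {x}) \<in> measurable (restrict_space (uniform_measure lborel (ball 0 1)) (- {0})) proj_borel"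
proof -
  have "sets (restrict_space (uniform_measure lborel (ball (0::'a) 1)) (- {0})) =
      sets (restrict_space borel (- {0}))"
    by (rule sets_restrict_space_cong) simp
  then show ?thesis
    using measurable_span_singleton measurable_cong_sets by blast
qed

lemma finite_measure_proj_uniform: "finite_measure proj_uniform"
proof -
  interpret prob_space "uniform_measure lborel (ball (0::'a) 1)"
    using emeasure_unit_ball(1) less_imp_neq[OF emeasure_unit_ball(2)]
    by (rule prob_space_uniform_measure)
  have "finite_measure (restrict_space (uniform_measure lborel (ball (0::'a) 1)) (- {0}))"
    by (rule finite_measure_restrict_space) (auto intro: finite_measure_axioms)
  then show ?thesis unfolding proj_uniform_def
    by (rule finite_measure.finite_measure_distr[OF _ measurable_span_unit_ball])
qed

interpretation radial: pair_sigma_finite lborel proj_uniform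
  by (intro pair_sigma_finite.intro finite_measure.axioms(1)[OF finite_measure_proj_uniform]
      lborel.sigma_finite_measure_axioms)

text \<open>Translates null sets of lines into null cones in the unit ball, where Fubini with a
  scaling parameter can be used.\<close>

lemma AE_proj_uniformD:
  assumes "AE \<theta> in proj_uniform. P \<theta>"
  shows "AE x in lborel. x \<in> ball 0 1 \<longrightarrow> x \<noteq> 0 \<longrightarrow> P (span {x})"
proof -
  have "AE x in restrict_space (uniform_measure lborel (ball 0 1)) (- {0}). P (span {x})"
    using assms unfolding proj_uniform_def by (rule AE_distrD[OF measurable_span_unit_ball])
  then show ?thesis
    by (subst (asm) AE_restrict_space_iff) (auto simp: AE_uniform_measure[OF emeasure_unit_ball])
qed

lemma unit_direction_span:
  assumes "unit_direction u" "x \<noteq> 0"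
  shows "(x \<bullet> u (span {x})) *\<^sub>R u (span {x}) = x"
proof -
  have u: "u (span {x}) \<in> span {x}" "norm (u (span {x})) = 1"
    using assms span_in_lines by (auto simp: unit_direction_def)
  then obtain k where k: "u (span {x}) = k *\<^sub>R x" by (auto simp: span_singleton)
  have "u (span {x}) \<bullet> u (span {x}) = 1"
    using u(2) by (simp only: norm_eq_1)
  then have "k * k * (x \<bullet> x) = 1" by (simp add: k)
  then show ?thesis by (simp add: k mult_ac)
qed

lemma measurable_unit_direction:
  assumes "unit_direction u"
  shows "u \<in> measurable proj_borel borel"
  using assms by (simp add: unit_direction_def)

lemma measurable_polar:
  assumes "unit_direction u"
  shows "polar u \<in> measurable (restrict_space borel (- {0})) (lborel \<Otimes>\<^sub>M proj_uniform)"
proof -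
  note [measurable] = measurable_span_singleton measurable_unit_direction[OF assms]
  have [measurable]: "(\<lambda>x. x) \<in> measurable (restrict_space borel (- {0})) borel"
    by (rule measurable_restrict_space1) simp
  have "(\<lambda>x. (x \<bullet> u (span {x}), span {x})) \<in>
      measurable (restrict_space borel (- {0})) (lborel \<Otimes>\<^sub>M proj_uniform)"
    by measurable
  then show ?thesis by (simp add: polar_def[abs_def])
qed

lemma polar_scaleR:
  "s \<noteq> 0 \<Longrightarrow> polar u (s *\<^sub>R x) = (s * (x \<bullet> u (span {x})), span {x})"
  using span_image_scale[of "{x}" "\<lambda>_. s"] by (simp add: polar_def)

lemma AE_lborel_scaleR:
  fixes P :: "'a::euclidean_space \<Rightarrow> bool"
  assumes "AE x in lborel. P (s *\<^sub>R x)" "s \<noteq> 0" and [measurable]: "Measurable.pred borel P"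
  shows "AE x in lborel. P x"
proof -
  have "AE x in distr lborel borel (\<lambda>x. s *\<^sub>R x). P x"
    using assms by (subst AE_distr_iff) auto
  then have "AE x in density (distr lborel borel (\<lambda>x. 0 + s *\<^sub>R x)) (\<lambda>_. \<bar>s\<bar> ^ DIM('a)). P x"
    by (subst AE_density) (simp_all only: add_0, simp_all)
  then show ?thesis by (simp only: lborel_affine[OF assms(2), of 0, symmetric])
qed

text \<open>By Fubini, for almost every \<open>x\<close> in the unit ball the set of \<open>s\<close> for which \<open>s x\<close> has polar
  coordinates in \<open>A\<close> is null. Exchanging the order, for almost every \<open>s\<close> the preimage of \<open>A\<close> is
  null in the ball of radius \<open>s\<close>; no explicit Jacobian is needed.\<close>
lemma polar_vimage_null:
  fixes u :: "'a::euclidean_space set \<Rightarrow> 'a"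
  assumes u: "unit_direction u" and A: "A \<in> null_sets (lborel \<Otimes>\<^sub>M proj_uniform)"
  shows "{x. x \<noteq> 0 \<and> polar u x \<in> A} \<in> null_sets lborel"
proof -
  define P where "P = {x. x \<noteq> 0 \<and> polar u x \<in> A}"
  have A_sets [measurable]: "A \<in> sets (lborel \<Otimes>\<^sub>M proj_uniform)" using A by auto
  have "polar u -` A \<inter> space (restrict_space borel (- {0})) \<in> sets (restrict_space borel (- {0}))"
    by (rule measurable_sets[OF measurable_polar[OF u] A_sets])
  moreover have "polar u -` A \<inter> space (restrict_space borel (- {0})) = P"
    by (auto simp: P_def space_restrict_space)
  ultimately have P [measurable]: "P \<in> sets borel" by (simp add: sets_restrict_space_iff)
  have "AE z in lborel \<Otimes>\<^sub>M proj_uniform. z \<notin> A" by (rule AE_not_in[OF A])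
  from radial.AE_pair[OF this] have "AE r in lborel. AE \<theta> in proj_uniform. (r, \<theta>) \<notin> A" by simp
  moreover have "{z \<in> space (lborel \<Otimes>\<^sub>M proj_uniform). (fst z, snd z) \<notin> A}
      \<in> sets (lborel \<Otimes>\<^sub>M proj_uniform)"
    using sets.compl_sets[OF A_sets] by (simp add: set_diff_eq)
  ultimately have "AE \<theta> in proj_uniform. AE r in lborel. (r, \<theta>) \<notin> A"
    by (simp only: radial.AE_commute)
  from AE_proj_uniformD[OF this]
  have "AE x::'a in lborel. AE s in lborel. x \<in> ball 0 1 \<longrightarrow> s \<noteq> 0 \<longrightarrow> s *\<^sub>R x \<notin> P"
  proof eventually_elim
    case (elim x)
    show ?case
    proof (cases "x \<in> ball 0 1 \<and> x \<noteq> 0")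
      case False
      then show ?thesis by (auto simp: P_def)
    next
      case True
      then have [measurable]: "(\<lambda>r. (r, span {x})) \<in> measurable borel (lborel \<Otimes>\<^sub>M proj_uniform)"
        by (intro measurable_Pair measurable_const) (simp_all add: span_in_lines)
      have "x \<bullet> u (span {x}) \<noteq> 0"
        using unit_direction_span[OF u, of x] True by auto
      moreover have [measurable]: "Measurable.pred borel (\<lambda>r. (r, span {x}) \<notin> A)"
        by measurable
      \<comment> \<open>Along the ray through \<open>x\<close> the signed radius is a nonzero
        multiple of \<open>s\<close>, so null sets of radii pull back to null sets of
        scales.\<close>
      ultimately have "AE s in lborel. (0 + (x \<bullet> u (span {x})) * s, span {x}) \<notin> A"
        using elim True by (intro AE_borel_affine) auto
      then show ?thesis
        by eventually_elim (use True in \<open>auto simp: P_def polar_scaleR mult.commute\<close>)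
    qed
  qed
  moreover have "Measurable.pred (lborel \<Otimes>\<^sub>M lborel)
      (\<lambda>z::'a \<times> real. fst z \<in> ball 0 1 \<longrightarrow> snd z \<noteq> 0 \<longrightarrow> snd z *\<^sub>R fst z \<notin> P)"
    unfolding mem_ball_0 by measurable
  ultimately have scales:
    "AE s in lborel. AE x::'a in lborel. x \<in> ball 0 1 \<longrightarrow> s \<noteq> 0 \<longrightarrow> s *\<^sub>R x \<notin> P"
    unfolding pred_def by (simp only: lborel_pair.AE_commute)
  have "AE y in lborel. y \<in> ball 0 (real n) \<longrightarrow> y \<notin> P" for n
  proof -
    \<comment> \<open>Almost every scale is good, so a good one exists above any \<open>n\<close>:
      otherwise an interval of length 1 would be null. Balls of such radii exhaust the
      space.\<close>
    have "\<exists>s > real n. AE x::'a in lborel. x \<in> ball 0 1 \<longrightarrow> s \<noteq> 0 \<longrightarrow> s *\<^sub>R x \<notin> P"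
    proof (rule ccontr)
      assume *: "\<not> ?thesis"
      from scales have "AE s in lborel. s \<notin> {real n<..<real n + 1}"
        by eventually_elim (use * in auto)
      then have "emeasure lborel {real n<..<real n + 1} = 0"
        by (subst (asm) AE_iff_measurable[of "{real n<..<real n + 1}"]) auto
      then show False by simp
    qed
    then obtain s where s: "s > real n"
      and ae: "AE x::'a in lborel. x \<in> ball 0 1 \<longrightarrow> s \<noteq> 0 \<longrightarrow> s *\<^sub>R x \<notin> P" by blast
    then have s0: "s > 0" by linarith
    have "AE y in lborel. y \<in> ball 0 s \<longrightarrow> y \<notin> P"
    proof (rule AE_lborel_scaleR)
      show "AE x in lborel. s *\<^sub>R x \<in> ball 0 s \<longrightarrow> s *\<^sub>R x \<notin> P"
        using ae by eventually_elim (use s0 in auto)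
      show "Measurable.pred borel (\<lambda>y. y \<in> ball 0 s \<longrightarrow> y \<notin> P)"
        unfolding mem_ball_0 by measurable
    qed (use s0 in simp)
    then show ?thesis by eventually_elim (use s in auto)
  qed
  then have "AE y in lborel. \<forall>n. y \<in> ball 0 (real n) \<longrightarrow> y \<notin> P"
    by (subst AE_all_countable) blast
  then have "AE y in lborel. y \<notin> P"
  proof eventually_elim
    case (elim y)
    obtain n where "norm y < real n" using reals_Archimedean2 by blast
    then show ?case using elim by auto
  qed
  then show ?thesis using P by (simp add: AE_iff_null_sets P_def[symmetric])
qed

section \<open>Rearrangement along the lines\<close>

lemma atomless_density_lborel:
  assumes [measurable]: "f \<in> borel_measurable borel" and fin: "(\<integral>\<^sup>+r. f r \<partial>lborel) \<noteq> \<infinity>"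
  shows "atomless_measure (density lborel f)"
proof -
  have "emeasure (density lborel f) {x} = 0" for x
  proof -
    have "AE r in lborel. f r * indicator {x} r = 0"
      using AE_lborel_singleton[of x] by eventually_elim auto
    then show ?thesis by (simp add: emeasure_density nn_integral_0_iff_AE)
  qed
  moreover have "finite_measure (density lborel f)"
    using fin by (intro finite_measureI) (simp add: emeasure_density)
  ultimately show ?thesis
    by (intro atomless_measure.intro finite_borel_measure.intro finite_borel_measure_axioms.intro
        atomless_measure_axioms.intro) (simp_all add: measure_def)
qed

locale radial_density =
  fixes u :: "'a::euclidean_space set \<Rightarrow> 'a" and \<rho> :: "'a measure"
  assumes prob: "prob_space \<rho>" and sets_rho: "sets \<rho> = sets borel"
    and ac: "absolutely_continuous lborel \<rho>" and u: "unit_direction u"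
begin

abbreviation "R \<equiv> restrict_space \<rho> (- {0})"
abbreviation "L \<equiv> (lborel :: real measure) \<Otimes>\<^sub>M (proj_uniform :: 'a set measure)"
abbreviation "polar_law \<equiv> distr R L (polar u)"
abbreviation "f \<equiv> polar_density u \<rho>"
abbreviation "line \<equiv> line_measure u \<rho>"

section \<open>The polar law and its disintegration along lines\<close>

lemma sets_R: "sets R = sets (restrict_space borel (- {0}))"
  by (rule sets_restrict_space_cong) (rule sets_rho)

lemma space_rho: "space \<rho> = UNIV"
  using sets_eq_imp_space_eq[OF sets_rho] by simp

lemma AE_nonzero: "AE x in \<rho>. x \<noteq> 0"
proof -
  have "{0} \<in> null_sets (lborel :: 'a measure)" by (simp add: null_sets_def)
  then have "{0} \<in> null_sets \<rho>" using ac by (auto simp: absolutely_continuous_def)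
  from AE_not_in[OF this] show ?thesis by simp
qed

lemma measurable_polar_R: "polar u \<in> measurable R L"
  using measurable_polar[OF u] by (simp add: measurable_cong_sets[OF sets_R refl])

lemma finite_polar_law: "finite_measure polar_law"
proof -
  interpret prob_space \<rho> by (rule prob)
  show ?thesis
    by (intro finite_measure.finite_measure_distr[OF _ measurable_polar_R] finite_measure_restrict_space
        finite_measure_axioms) (simp add: sets_rho)
qed

text \<open>This is what makes \<open>RN_deriv\<close> a genuine density here.\<close>

lemma absolutely_continuous_polar_law: "absolutely_continuous L polar_law"
  unfolding absolutely_continuous_def
proof
  fix A assume A: "A \<in> null_sets L"
  have "{x. x \<noteq> 0 \<and> polar u x \<in> A} \<in> null_sets \<rho>"
    using polar_vimage_null[OF u A] ac by (auto simp: absolutely_continuous_def)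
  moreover have "polar u -` A \<inter> space R = {x. x \<noteq> 0 \<and> polar u x \<in> A}"
    by (auto simp: space_restrict_space space_rho)
  ultimately show "A \<in> null_sets polar_law"
    using A measurable_polar_R
    by (auto simp: null_sets_def emeasure_distr emeasure_restrict_space sets_rho)
qed

lemma measurable_f [measurable]: "f \<in> borel_measurable L"
  unfolding polar_density_def by (rule borel_measurable_RN_deriv)

lemma density_f: "density L f = polar_law"
proof -
  have "sigma_finite_measure L" by unfold_locales
  then show ?thesis unfolding polar_density_def
    by (rule sigma_finite_measure.density_RN_deriv[OF _ absolutely_continuous_polar_law]) simp
qed

lemma measurable_f_section [measurable]:
  "\<theta> \<in> lines \<Longrightarrow> (\<lambda>r. f (r, \<theta>)) \<in> borel_measurable borel"
  using measurable_compose[OF _ measurable_f, of "\<lambda>r. (r, \<theta>)" borel]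
  by (simp add: measurable_Pair)

lemma nn_integral_polar_law:
  assumes [measurable]: "h \<in> borel_measurable L"
  shows "(\<integral>\<^sup>+z. h z \<partial>polar_law) = (\<integral>\<^sup>+\<theta>. (\<integral>\<^sup>+r. h (r, \<theta>) \<partial>line \<theta>) \<partial>proj_uniform)"
proof -
  have "(\<integral>\<^sup>+z. h z \<partial>polar_law) = (\<integral>\<^sup>+z. f z * h z \<partial>L)"
    by (simp add: density_f[symmetric] nn_integral_density)
  also have "\<dots> = (\<integral>\<^sup>+\<theta>. (\<integral>\<^sup>+r. f (r, \<theta>) * h (r, \<theta>) \<partial>lborel) \<partial>proj_uniform)"
    by (rule radial.nn_integral_snd[symmetric]) measurable
  also have "\<dots> = (\<integral>\<^sup>+\<theta>. (\<integral>\<^sup>+r. h (r, \<theta>) \<partial>line \<theta>) \<partial>proj_uniform)"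
  proof (rule nn_integral_cong)
    fix \<theta> :: "'a set" assume "\<theta> \<in> space proj_uniform"
    then have [simp]: "\<theta> \<in> lines" by simp
    have "(\<lambda>r. h (r, \<theta>)) \<in> borel_measurable borel"
      using measurable_compose[OF _ assms, of "\<lambda>r. (r, \<theta>)" borel] by (simp add: measurable_Pair)
    then show "(\<integral>\<^sup>+r. f (r, \<theta>) * h (r, \<theta>) \<partial>lborel) = (\<integral>\<^sup>+r. h (r, \<theta>) \<partial>line \<theta>)"
      by (simp add: line_measure_def nn_integral_density)
  qed
  finally show ?thesis .
qed

section \<open>Line measures: finiteness, joint measurability and invariance\<close>

lemma sets_line: "sets (line \<theta>) = sets borel"
  by (simp add: line_measure_def)

lemma AE_line_finite: "AE \<theta> in proj_uniform. emeasure (line \<theta>) UNIV \<noteq> \<infinity>"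
proof -
  have eq: "emeasure (line \<theta>) UNIV = (\<integral>\<^sup>+r. f (r, \<theta>) \<partial>lborel)" if "\<theta> \<in> lines" for \<theta>
    using that by (simp add: line_measure_def emeasure_density)
  have "(\<integral>\<^sup>+\<theta>. (\<integral>\<^sup>+r. f (r, \<theta>) \<partial>lborel) \<partial>proj_uniform) = emeasure polar_law (space L)"
    unfolding radial.nn_integral_snd[OF measurable_f] density_f[symmetric]
    by (subst emeasure_density[OF measurable_f sets.top]) (auto intro!: nn_integral_cong)
  also have "\<dots> \<noteq> \<infinity>"
    using finite_measure.emeasure_finite[OF finite_polar_law] by simp
  finally have "AE \<theta> in proj_uniform. (\<integral>\<^sup>+r. f (r, \<theta>) \<partial>lborel) \<noteq> \<infinity>"
    by (intro nn_integral_PInf_AE) measurable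
  with AE_space show ?thesis by eventually_elim (auto simp: eq)
qed

lemma atomless_line:
  assumes "\<theta> \<in> lines" "emeasure (line \<theta>) UNIV \<noteq> \<infinity>"
  shows "atomless_measure (line \<theta>)"
  using assms unfolding line_measure_def
  by (intro atomless_density_lborel) (simp_all add: emeasure_density)

text \<open>The measure itself varies with \<open>z\<close>. Writing its distribution function as a
  parameter integral of the jointly measurable density, with the cut-off inside the integrand, makes
  Tonelli measurability applicable.\<close>

lemma measurable_cdf_line [measurable]:
  assumes [measurable]: "g \<in> measurable K borel" "h \<in> measurable K proj_uniform"
  shows "(\<lambda>z. cdf (line (h z)) (g z)) \<in> borel_measurable K"
proof -
  have "(\<lambda>z. enn2real (\<integral>\<^sup>+s. f (s, h z) * (if s \<le> g z then 1 else 0) \<partial>lborel)) \<in> borel_measurable K"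
    by measurable
  moreover have "cdf (line (h z)) (g z) =
      enn2real (\<integral>\<^sup>+s. f (s, h z) * (if s \<le> g z then 1 else 0) \<partial>lborel)" if "z \<in> space K" for z
  proof -
    have "h z \<in> lines" using measurable_space[OF assms(2) that] by simp
    then show ?thesis
      by (auto simp: cdf_def measure_def line_measure_def emeasure_density indicator_def
          intro!: arg_cong[where f=enn2real] nn_integral_cong)
  qed
  ultimately show ?thesis by (simp cong: measurable_cong)
qed

lemma measurable_mass_line [measurable]:
  assumes [measurable]: "h \<in> measurable K proj_uniform"
  shows "(\<lambda>z. measure (line (h z)) UNIV) \<in> borel_measurable K"
proof -
  have "(\<lambda>z. enn2real (\<integral>\<^sup>+s. f (s, h z) \<partial>lborel)) \<in> borel_measurable K"
    by measurable
  moreover have "measure (line (h z)) UNIV =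
      enn2real (\<integral>\<^sup>+s. f (s, h z) \<partial>lborel)" if "z \<in> space K" for z
  proof -
    have "h z \<in> lines" using measurable_space[OF assms that] by simp
    then show ?thesis by (simp add: measure_def line_measure_def emeasure_density)
  qed
  ultimately show ?thesis by (simp cong: measurable_cong)
qed

lemma measurable_cyclic_shift [measurable]:
  assumes [measurable]: "a \<in> borel_measurable K" "p \<in> borel_measurable K"
  shows "(\<lambda>z. cyclic_shift (a z) N m (p z)) \<in> borel_measurable K"
  unfolding cyclic_shift_def Let_def by measurable

abbreviation "regular N m z \<equiv> regular_point (line (snd z)) N m (fst z)"

lemma measurable_regular [measurable]: "Measurable.pred L (regular N m)"
  unfolding regular_point_def by measurable

text \<open>The value 0 at irregular points replaces the uncontrolled values of \<open>THE\<close>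
  and keeps sublevel sets measurable.\<close>

definition radial_part :: "nat \<Rightarrow> nat \<Rightarrow> real \<times> 'a set \<Rightarrow> real" where
  "radial_part N m z = (if regular N m z then cyclic_map (line (snd z)) N m (fst z) else 0)"

lemma regular_imp_finite:
  assumes "regular N m z" shows "emeasure (line (snd z)) UNIV \<noteq> \<infinity>"
  using assms by (auto simp: regular_point_def measure_def)

lemma measurable_radial_part:
  assumes m: "m \<in> {1..N}"
  shows "radial_part N m \<in> borel_measurable L"
proof (subst borel_measurable_iff_le, rule allI)
  fix s
  have "{z \<in> space L. radial_part N m z \<le> s} = {z \<in> space L.
      if regular N m z then cyclic_shift (measure (line (snd z)) UNIV) N m (cdf (line (snd z)) (fst z))
        \<le> cdf (line (snd z)) s else 0 \<le> s}"
  proof (rule Collect_cong, rule conj_cong[OF refl])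
    fix z assume "z \<in> space L"
    then have "snd z \<in> lines" by (auto simp: space_pair_measure)
    then show "radial_part N m z \<le> s \<longleftrightarrow> (if regular N m z
        then cyclic_shift (measure (line (snd z)) UNIV) N m (cdf (line (snd z)) (fst z))
          \<le> cdf (line (snd z)) s else 0 \<le> s)"
      using atomless_measure.cyclic_map_le_iff[OF atomless_line m] regular_imp_finite
      by (simp add: radial_part_def)
  qed
  also have "\<dots> \<in> sets L" by measurable
  finally show "{z \<in> space L. radial_part N m z \<le> s} \<in> sets L" .
qed

lemma distr_line:
  assumes m: "m \<in> {1..N}" and \<theta>: "\<theta> \<in> lines" and fin: "emeasure (line \<theta>) UNIV \<noteq> \<infinity>"
  shows "distr (line \<theta>) borel (\<lambda>r. radial_part N m (r, \<theta>)) = line \<theta>"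
proof -
  interpret atomless_measure "line \<theta>" by (rule atomless_line[OF \<theta> fin])
  have g [measurable]: "(\<lambda>r. radial_part N m (r, \<theta>)) \<in> borel_measurable borel"
    using measurable_compose[OF _ measurable_radial_part[OF m], of "\<lambda>r. (r, \<theta>)" borel] \<theta>
    by (simp add: measurable_Pair)
  show ?thesis
  proof (cases "measure (line \<theta>) UNIV = 0")
    case False
    then have "0 < measure (line \<theta>) UNIV" by (simp add: zero_less_measure_iff)
    then show ?thesis
      by (rule distr_cyclic_map[OF _ m g]) (simp add: radial_part_def)
  next
    \<comment> \<open>A line without mass has no regular points, but both sides are then the zero
      measure.\<close>
    case True
    have "emeasure (line \<theta>) A = 0" for A
      using emeasure_mono[of A UNIV "line \<theta>"] True sets.top[of "line \<theta>"]
      by (simp add: emeasure_eq_measure borel_UNIV measure_le_0_iff)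
    then show ?thesis
      by (intro measure_eqI) (auto simp: sets_line emeasure_distr measurable_cong_sets[OF sets_line refl])
  qed
qed

text \<open>The map fixes the line, so integrating the one-dimensional invariance over almost every
  line suffices; the lines of infinite mass form a null set.\<close>

lemma distr_polar_law:
  assumes m: "m \<in> {1..N}"
  shows "distr polar_law L (\<lambda>z. (radial_part N m z, snd z)) = polar_law"
proof (rule measure_eqI)
  note [measurable] = measurable_radial_part[OF m]
  fix A assume "A \<in> sets (distr polar_law L (\<lambda>z. (radial_part N m z, snd z)))"
  then have A [measurable]: "A \<in> sets L" by simp
  have "emeasure (distr polar_law L (\<lambda>z. (radial_part N m z, snd z))) A =
      (\<integral>\<^sup>+z. indicator A z \<partial>distr polar_law L (\<lambda>z. (radial_part N m z, snd z)))"
    using A by simp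
  also have "\<dots> = (\<integral>\<^sup>+z. indicator A (radial_part N m z, snd z) \<partial>polar_law)"
    by (subst nn_integral_distr) simp_all
  also have "\<dots> = (\<integral>\<^sup>+\<theta>. (\<integral>\<^sup>+r. indicator A (radial_part N m (r, \<theta>), \<theta>) \<partial>line \<theta>) \<partial>proj_uniform)"
    by (subst nn_integral_polar_law) simp_all
  also have "\<dots> = (\<integral>\<^sup>+\<theta>. (\<integral>\<^sup>+r. indicator A (r, \<theta>) \<partial>line \<theta>) \<partial>proj_uniform)"
  proof (rule nn_integral_cong_AE)
    show "AE \<theta> in proj_uniform. (\<integral>\<^sup>+r. indicator A (radial_part N m (r, \<theta>), \<theta>) \<partial>line \<theta>) =
        (\<integral>\<^sup>+r. indicator A (r, \<theta>) \<partial>line \<theta>)"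
      using AE_line_finite AE_space
    proof eventually_elim
      case (elim \<theta>)
      then have \<theta>: "\<theta> \<in> lines" by simp
      have [measurable]: "(\<lambda>r. (r, \<theta>)) \<in> measurable borel L"
        using \<theta> by (simp add: measurable_Pair)
      have "(\<lambda>r. radial_part N m (r, \<theta>)) \<in> borel_measurable borel" by measurable
      moreover have "(\<lambda>r. indicator A (r, \<theta>) :: ennreal) \<in> borel_measurable borel" by measurable
      ultimately have "(\<integral>\<^sup>+r. indicator A (r, \<theta>) \<partial>distr (line \<theta>) borel (\<lambda>r. radial_part N m (r, \<theta>))) =
          (\<integral>\<^sup>+r. indicator A (radial_part N m (r, \<theta>), \<theta>) \<partial>line \<theta>)"
        by (intro nn_integral_distr) (simp_all add: measurable_cong_sets[OF sets_line refl])
      then show ?case by (simp add: distr_line[OF m \<theta> elim(1)])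
    qed
  qed
  also have "\<dots> = (\<integral>\<^sup>+z. indicator A z \<partial>polar_law)"
    by (rule nn_integral_polar_law[symmetric]) simp
  also have "\<dots> = emeasure polar_law A" using A by simp
  finally show "emeasure (distr polar_law L (\<lambda>z. (radial_part N m z, snd z))) A = emeasure polar_law A" .
qed simp

lemma AE_regular:
  assumes m: "m \<in> {1..N}"
  shows "AE x in \<rho>. x \<noteq> 0 \<longrightarrow> regular N m (polar u x)"
proof -
  have irregular [measurable]: "{z \<in> space L. \<not> regular N m z} \<in> sets L" by measurable
  have "emeasure polar_law {z \<in> space L. \<not> regular N m z} =
      (\<integral>\<^sup>+z. indicator {z \<in> space L. \<not> regular N m z} z \<partial>polar_law)"
    using irregular by simp
  also have "\<dots> = (\<integral>\<^sup>+\<theta>. (\<integral>\<^sup>+r. indicator {z \<in> space L. \<not> regular N m z} (r, \<theta>) \<partial>line \<theta>) \<partial>proj_uniform)"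
    by (rule nn_integral_polar_law) simp
  also have "\<dots> = (\<integral>\<^sup>+\<theta>. 0 \<partial>(proj_uniform :: 'a set measure))"
  proof (rule nn_integral_cong_AE)
    show "AE \<theta> in proj_uniform. (\<integral>\<^sup>+r. indicator {z \<in> space L. \<not> regular N m z} (r, \<theta>) \<partial>line \<theta>) = 0"
      using AE_line_finite AE_space
    proof eventually_elim
      case (elim \<theta>)
      interpret atomless_measure "line \<theta>" using elim by (intro atomless_line) simp_all
      have "AE r in line \<theta>. regular N m (r, \<theta>)"
      proof (cases "measure (line \<theta>) UNIV = 0")
        case False
        then have "0 < measure (line \<theta>) UNIV" by (simp add: zero_less_measure_iff)
        then show ?thesis using AE_regular_point[of N m] m by simp
      next
        case True
        then have "UNIV \<in> null_sets (line \<theta>)"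
          by (intro null_setsI) (simp_all add: emeasure_eq_measure sets_line)
        from AE_not_in[OF this] show ?thesis by eventually_elim simp
      qed
      then have "(\<integral>\<^sup>+r. indicator {z \<in> space L. \<not> regular N m z} (r, \<theta>) \<partial>line \<theta>) =
          (\<integral>\<^sup>+r. 0 \<partial>line \<theta>)"
        by (intro nn_integral_cong_AE) (auto elim!: eventually_mono)
      then show ?case by simp
    qed
  qed
  finally have "AE z in polar_law. regular N m z"
    using irregular by (subst AE_iff_measurable[OF _ refl]) simp_all
  from AE_distrD[OF measurable_polar_R this] show ?thesis
    by (subst (asm) AE_restrict_space_iff) (simp_all add: sets_rho)
qed

text \<open>A Borel representative of T^m on the whole space. The value at the origin is a
  convention on a null set.\<close>

definition transport :: "nat \<Rightarrow> nat \<Rightarrow> 'a \<Rightarrow> 'a" where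
  "transport N m x = (if x = 0 then 0 else radial_part N m (polar u x) *\<^sub>R u (span {x}))"

lemma AE_transport:
  assumes m: "m \<in> {1..N}"
  shows "AE x in \<rho>. radial_map u \<rho> N m x = transport N m x"
  using AE_regular[OF m] AE_nonzero
  by eventually_elim
    (simp add: radial_map_def transport_def radial_part_def polar_def)

lemma measurable_transport:
  assumes m: "m \<in> {1..N}"
  shows "transport N m \<in> borel_measurable borel"
proof -
  note [measurable] = measurable_span_singleton measurable_unit_direction[OF u] measurable_polar[OF u]
    measurable_radial_part[OF m]
  have "(\<lambda>x. radial_part N m (polar u x) *\<^sub>R u (span {x})) \<in> borel_measurable (restrict_space borel (- {0}))"
    by measurable
  then have "(\<lambda>x. indicator (- {0}) x *\<^sub>R (radial_part N m (polar u x) *\<^sub>R u (span {x}))) \<in> borel_measurable borel"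
    by (subst (asm) borel_measurable_restrict_space_iff) simp_all
  also have "(\<lambda>x. indicator (- {0}) x *\<^sub>R (radial_part N m (polar u x) *\<^sub>R u (span {x}))) = transport N m"
    by (auto simp: transport_def fun_eq_iff)
  finally show ?thesis .
qed

lemma distr_R:
  assumes [measurable]: "h \<in> borel_measurable borel"
  shows "distr R borel h = distr \<rho> borel h"
proof (rule measure_eqI)
  fix A assume "A \<in> sets (distr R borel h)"
  then have A [measurable]: "A \<in> sets borel" by simp
  have [measurable_cong]: "sets \<rho> = sets borel" by (rule sets_rho)
  have "h \<in> measurable R borel" by (rule measurable_restrict_space1) measurable
  then have "emeasure (distr R borel h) A = emeasure R (h -` A \<inter> space R)"
    by (simp add: emeasure_distr)
  also have "\<dots> = emeasure \<rho> (h -` A \<inter> space R)"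
    by (rule emeasure_restrict_space) (auto simp: sets_rho space_restrict_space)
  also have "\<dots> = emeasure \<rho> (h -` A \<inter> space \<rho>)"
  proof (rule emeasure_eq_AE)
    show "AE x in \<rho>. x \<in> h -` A \<inter> space R \<longleftrightarrow> x \<in> h -` A \<inter> space \<rho>"
      using AE_nonzero by eventually_elim (auto simp: space_restrict_space space_rho)
    show "h -` A \<inter> space \<rho> \<in> sets \<rho>" by measurable
    then have "(h -` A \<inter> space \<rho>) \<inter> - {0} \<in> sets \<rho>" by (rule sets.Int) (simp add: sets_rho)
    moreover have "h -` A \<inter> space R = (h -` A \<inter> space \<rho>) \<inter> - {0}"
      by (auto simp: space_restrict_space space_rho)
    ultimately show "h -` A \<inter> space R \<in> sets \<rho>" by simp
  qed
  also have "\<dots> = emeasure (distr \<rho> borel h) A"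
    by (simp add: emeasure_distr)
  finally show "emeasure (distr R borel h) A = emeasure (distr \<rho> borel h) A" .
qed simp

lemma distr_transport:
  assumes m: "m \<in> {1..N}"
  shows "distr \<rho> borel (transport N m) = \<rho>"
proof -
  note [measurable] = measurable_unit_direction[OF u] measurable_polar_R measurable_radial_part[OF m]
  let ?S = "\<lambda>z. (radial_part N m z, snd z)" and ?\<psi> = "\<lambda>z. fst z *\<^sub>R u (snd z)"
  have \<psi> [measurable]: "?\<psi> \<in> borel_measurable L" by measurable
  have S [measurable]: "?S \<in> measurable L L" by measurable
  have "distr \<rho> borel (transport N m) = distr R borel (transport N m)"
    by (rule distr_R[OF measurable_transport[OF m], symmetric])
  also have "\<dots> = distr R borel (?\<psi> \<circ> (?S \<circ> polar u))"
    by (rule distr_cong) (auto simp: space_restrict_space transport_def polar_def)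
  also have "\<dots> = distr (distr polar_law L ?S) borel ?\<psi>"
    by (simp add: distr_distr measurable_comp[OF measurable_polar_R S] measurable_polar_R)
  also have "\<dots> = distr polar_law borel ?\<psi>" by (simp add: distr_polar_law[OF m])
  also have "\<dots> = distr R borel (?\<psi> \<circ> polar u)"
    by (simp add: distr_distr measurable_polar_R)
  also have "\<dots> = distr R borel (\<lambda>x. x)"
    by (rule distr_cong) (auto simp: space_restrict_space polar_def unit_direction_span[OF u])
  also have "\<dots> = distr \<rho> borel (\<lambda>x. x)" by (rule distr_R) simp
  also have "\<dots> = \<rho>" by (rule distr_id2) (simp add: sets_rho)
  finally show ?thesis .
qed

end

section \<open>Transport plans\<close>

text \<open>Preimages under \<open>f\<close> and \<open>g\<close> differ only inside a null set, and
  the completion contains all such modifications. This covers any version of T^m.\<close>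

lemma measurable_completion_AE:
  assumes g: "g \<in> measurable M borel" and ae: "AE x in M. f x = g x"
  shows "f \<in> measurable (completion M) borel"
proof (rule measurableI)
  fix A :: "'b::topological_space set" assume A: "A \<in> sets borel"
  show "f -` A \<inter> space (completion M) \<in> sets (completion M)"
  proof (rule completion.in_sets_AE)
    show "AE x in completion M. x \<in> g -` A \<inter> space M \<longleftrightarrow> x \<in> f -` A \<inter> space (completion M)"
      using AE_completion[OF ae] by eventually_elim simp
    show "g -` A \<inter> space M \<in> sets (completion M)"
      using measurable_sets[OF g A] by simp
  qed simp
qed simp

lemma measurable_coulomb:
  "(coulomb N :: (nat \<Rightarrow> 'a::euclidean_space) \<Rightarrow> ennreal) \<in> borel_measurable (PiM {1..N} (\<lambda>_. borel))"
proof -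
  have "(\<lambda>x. 1 / ennreal (norm (x i - x j :: 'a))) \<in> borel_measurable (PiM {1..N} (\<lambda>_. borel))"
    if "i \<in> {1..N}" "j \<in> {1..N}" for i j
  proof -
    have [measurable]: "(\<lambda>x. x i - x j :: 'a) \<in> borel_measurable (PiM {1..N} (\<lambda>_. borel))"
      by (intro borel_measurable_diff measurable_component_singleton that)
    show ?thesis by measurable
  qed
  then show ?thesis
    unfolding coulomb_def[abs_def] by (intro borel_measurable_sum) auto
qed

lemma joint_push_in_transport_plans:
  assumes prob: "prob_space \<rho>" and sets: "sets \<rho> = sets borel"
    and T: "\<And>i. i \<in> {1..N} \<Longrightarrow> T i \<in> borel_measurable (completion \<rho>)"
    and push: "\<And>i. i \<in> {1..N} \<Longrightarrow> distr (completion \<rho>) borel (T i) = \<rho>"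
  shows "joint_push N T \<rho> \<in> transport_plans N \<rho>"
proof -
  have m: "(\<lambda>x. \<lambda>i\<in>{1..N}. T i x) \<in> measurable (completion \<rho>) (PiM {1..N} (\<lambda>_. borel))"
    using T by (rule measurable_restrict)
  have "distr (joint_push N T \<rho>) borel (\<lambda>x. x i) = \<rho>" if i: "i \<in> {1..N}" for i
  proof -
    have "distr (joint_push N T \<rho>) borel (\<lambda>x. x i) =
        distr (completion \<rho>) borel ((\<lambda>x. x i) \<circ> (\<lambda>x. \<lambda>i\<in>{1..N}. T i x))"
      unfolding joint_push_def
      by (rule distr_distr[OF measurable_component_singleton[OF i] m])
    also have "(\<lambda>x. x i) \<circ> (\<lambda>x. \<lambda>i\<in>{1..N}. T i x) = T i" using i by (auto simp: comp_def)
    finally show ?thesis using push[OF i] by simp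
  qed
  moreover have "prob_space (joint_push N T \<rho>)"
    unfolding joint_push_def
    by (rule prob_space.prob_space_distr[OF prob_space.prob_space_completion[OF prob] m])
  ultimately show ?thesis by (simp add: transport_plans_def joint_push_def)
qed

lemma plan_cost_joint_push:
  assumes T: "\<And>i. i \<in> {1..N} \<Longrightarrow> T i \<in> borel_measurable (completion \<rho>)"
  shows "plan_cost N (joint_push N T \<rho>) = (\<integral>\<^sup>+x. coulomb N (\<lambda>i. T i x) \<partial>\<rho>)"
proof -
  have m: "(\<lambda>x. \<lambda>i\<in>{1..N}. T i x) \<in> measurable (completion \<rho>) (PiM {1..N} (\<lambda>_. borel))"
    using T by (rule measurable_restrict)
  have "plan_cost N (joint_push N T \<rho>) = (\<integral>\<^sup>+x. coulomb N (\<lambda>i\<in>{1..N}. T i x) \<partial>completion \<rho>)"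
    unfolding plan_cost_def joint_push_def by (rule nn_integral_distr[OF m]) (simp only: measurable_distr_eq1 measurable_coulomb)
  also have "\<dots> = (\<integral>\<^sup>+x. coulomb N (\<lambda>i. T i x) \<partial>\<rho>)"
    \<comment> \<open>The integrals against a measure and its completion agree for arbitrary
      integrands, so the last integral can be taken against \<open>\<rho>\<close> although
      \<open>T i\<close> is only measurable for the completion. The restriction disappears because
      \<open>coulomb\<close> only reads indices in \<open>{1..N}\<close>.\<close>
    unfolding nn_integral_completion coulomb_def by (intro nn_integral_cong sum.cong refl) simp
  finally show ?thesis .
qed

theorem corollary2p2p2:
  fixes N :: nat
    and \<rho> :: "(real ^ 'd) measure"
    and u :: "(real ^ 'd) set \<Rightarrow> real ^ 'd"
    and T :: "nat \<Rightarrow> real ^ 'd \<Rightarrow> real ^ 'd"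
  assumes "N \<ge> 2"
    and "prob_space \<rho>" and "sets \<rho> = sets borel"
    and "absolutely_continuous lborel \<rho>"
    and "unit_direction u"
    and "\<And>m. m \<in> {1..N} \<Longrightarrow> AE x in \<rho>. T m x = radial_map u \<rho> N m x"
  shows "min_cost N \<rho> \<le> plan_cost N (joint_push N T \<rho>) \<and>
    plan_cost N (joint_push N T \<rho>) =
      (\<integral>\<^sup>+x. (\<Sum>i\<in>{1..N}. \<Sum>j\<in>{1..N} - {i}. 1 / ennreal (norm (x i - x j))) \<partial>joint_push N T \<rho>) \<and>
    (\<integral>\<^sup>+x. (\<Sum>i\<in>{1..N}. \<Sum>j\<in>{1..N} - {i}. 1 / ennreal (norm (x i - x j))) \<partial>joint_push N T \<rho>) =
      (\<integral>\<^sup>+x. (\<Sum>i\<in>{1..N}. \<Sum>j\<in>{1..N} - {i}. 1 / ennreal (norm (T i x - T j x))) \<partial>\<rho>)"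
proof -
  interpret radial_density u \<rho> by (rule radial_density.intro) fact+
  \<comment> \<open>Measurability and invariance are known for the representative and pass to
    \<open>T\<close> through this almost-everywhere equality.\<close>
  have ae: "AE x in \<rho>. T i x = transport N i x" if "i \<in> {1..N}" for i
    using assms(6)[OF that] AE_transport[OF that] by eventually_elim simp
  have meas: "transport N i \<in> borel_measurable \<rho>" if "i \<in> {1..N}" for i
    using measurable_transport[OF that] by (simp add: measurable_cong_sets[OF sets_rho refl])
  have T: "T i \<in> borel_measurable (completion \<rho>)" if "i \<in> {1..N}" for i
    by (rule measurable_completion_AE[OF meas[OF that] ae[OF that]])
  have "distr (completion \<rho>) borel (T i) = \<rho>" if i: "i \<in> {1..N}" for i
  proof -
    have "distr (completion \<rho>) borel (T i) = distr (completion \<rho>) borel (transport N i)"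
      using AE_completion[OF ae[OF i]] T[OF i] measurable_completion[OF meas[OF i]]
      by (intro distr_cong_AE) simp_all
    also have "\<dots> = \<rho>"
      by (simp add: distr_completion[OF meas[OF i]] distr_transport[OF i])
    finally show ?thesis .
  qed
  with prob sets_rho T have "joint_push N T \<rho> \<in> transport_plans N \<rho>"
    by (rule joint_push_in_transport_plans)
  then have "min_cost N \<rho> \<le> plan_cost N (joint_push N T \<rho>)"
    unfolding min_cost_def by (rule INF_lower)
  with plan_cost_joint_push[OF T] show ?thesis
    by (simp add: plan_cost_def coulomb_def)
qed

end
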